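(* Let $m\geq0$ and $n\geq1$ be integers and let $a=(a_{ij})_{1\leq i,j\leq 2(n+m)}$ be (the height array of) an element of $\mathcal{S}_{n,m}$. Associate to $a$ the array $c=(c_{ij})_{1\leq i,j\leq n+m}$ with $c_{ij}=\max\{a_{i+n+m,j}-(n+m)-i+1,\,0\}$ (i.e. zero and negative entries are ignored). Then $c$ is a plane partition belonging to $\mathcal{C}_{n,m}$, and this map is a bijection of $\mathcal{S}_{n,m}$ onto $\mathcal{C}_{n,m}$.
   Context: A plane partition is identified with its Ferrers graph, a finite set $\pi\subset\mathbb{P}^3$ that is closed downward in each coordinate; its height array is $a_{ij}=\#\{z:(i,j,z)\in\pi\}$. Let $M=n+m$. A totally symmetric self-complementary plane partition of size $M$ is a plane partition $\pi\subseteq[2M]^3$ invariant under all permutations of coordinates with $(x,y,z)\in\pi$ iff $(2M+1-x,2M+1-y,2M+1-z)\notin\pi$ for all $(x,y,z)\in[2M]^3$. $\mathcal{S}_{n,m}$ is the set of such $\pi$ satisfying: every $(x,y,z)\in\pi$ with $n+1\leq x,y,z\leq n+2m$ has at least two of its coordinates $\leq n+m$. $\mathcal{C}_{n,m}$ is the set of plane partitions $c=(c_{ij})_{i,j\geq1}$ (arrays of nonnegative integers with finitely many nonzero entries, weakly decreasing along rows and columns) that have at most $n$ nonzero columns, whose nonzero entries are strictly decreasing down each column, and such that each nonzero entry in column $j$ is at most $n+m-j$. *)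

theory Defs
  imports Main
begin

text \<open>Plane partitions as Ferrers graphs: boxes have positive coordinates.\<close>

definition plane_partition :: "(nat \<times> nat \<times> nat) set \<Rightarrow> bool" where
  "plane_partition \<pi> \<longleftrightarrow>
     finite \<pi> \<and>
     (\<forall>x y z. (x, y, z) \<in> \<pi> \<longrightarrow> 1 \<le> x \<and> 1 \<le> y \<and> 1 \<le> z) \<and>
     (\<forall>x y z x' y' z'. (x, y, z) \<in> \<pi> \<longrightarrow>
        1 \<le> x' \<and> x' \<le> x \<and> 1 \<le> y' \<and> y' \<le> y \<and> 1 \<le> z' \<and> z' \<le> z \<longrightarrow> (x', y', z') \<in> \<pi>)"

definition height :: "(nat \<times> nat \<times> nat) set \<Rightarrow> nat \<Rightarrow> nat \<Rightarrow> nat" where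
  "height \<pi> i j = card {z. (i, j, z) \<in> \<pi>}"

definition totally_symmetric :: "(nat \<times> nat \<times> nat) set \<Rightarrow> bool" where
  "totally_symmetric \<pi> \<longleftrightarrow>
     (\<forall>x y z. (x, y, z) \<in> \<pi> \<longrightarrow>
        {(x, z, y), (y, x, z), (y, z, x), (z, x, y), (z, y, x)} \<subseteq> \<pi>)"

definition self_complementary :: "nat \<Rightarrow> (nat \<times> nat \<times> nat) set \<Rightarrow> bool" where
  "self_complementary M \<pi> \<longleftrightarrow>
     (\<forall>x\<in>{1..2 * M}. \<forall>y\<in>{1..2 * M}. \<forall>z\<in>{1..2 * M}.
        (x, y, z) \<in> \<pi> \<longleftrightarrow> (2 * M + 1 - x, 2 * M + 1 - y, 2 * M + 1 - z) \<notin> \<pi>)"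

definition TSSCPP :: "nat \<Rightarrow> (nat \<times> nat \<times> nat) set set" where
  "TSSCPP M = {\<pi>. plane_partition \<pi> \<and> \<pi> \<subseteq> {1..2 * M} \<times> {1..2 * M} \<times> {1..2 * M} \<and>
     totally_symmetric \<pi> \<and> self_complementary M \<pi>}"

definition S_set :: "nat \<Rightarrow> nat \<Rightarrow> (nat \<times> nat \<times> nat) set set" where
  "S_set n m = {\<pi> \<in> TSSCPP (n + m).
     \<forall>x\<in>{n + 1..n + 2 * m}. \<forall>y\<in>{n + 1..n + 2 * m}. \<forall>z\<in>{n + 1..n + 2 * m}.
       (x, y, z) \<in> \<pi> \<longrightarrow>
         (x \<le> n + m \<and> y \<le> n + m) \<or> (x \<le> n + m \<and> z \<le> n + m) \<or> (y \<le> n + m \<and> z \<le> n + m)}"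

text \<open>
  Plane partitions as arrays, with row index first. An array indexed by positive integers
  is encoded as a function on all pairs of naturals that is 0 whenever an index is 0, so that
  equality of arrays is equality of functions.
\<close>

definition plane_partition_array :: "(nat \<Rightarrow> nat \<Rightarrow> nat) \<Rightarrow> bool" where
  "plane_partition_array c \<longleftrightarrow>
     (\<forall>i j. i = 0 \<or> j = 0 \<longrightarrow> c i j = 0) \<and>
     finite {(i, j). c i j \<noteq> 0} \<and>
     (\<forall>i\<ge>1. \<forall>j\<ge>1. c i (j + 1) \<le> c i j \<and> c (i + 1) j \<le> c i j)"

text \<open>
  The bound on the entries of column j is written additively because subtraction on naturals
  truncates.
\<close>

definition C_set :: "nat \<Rightarrow> nat \<Rightarrow> (nat \<Rightarrow> nat \<Rightarrow> nat) set" where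
  "C_set n m = {c. plane_partition_array c \<and>
     card {j. \<exists>i. c i j \<noteq> 0} \<le> n \<and>
     (\<forall>i i' j. i < i' \<and> c i j \<noteq> 0 \<and> c i' j \<noteq> 0 \<longrightarrow> c i' j < c i j) \<and>
     (\<forall>i j. c i j \<noteq> 0 \<longrightarrow> c i j + j \<le> n + m)}"

text \<open>
  The array built from a height array a; it is extended by 0 outside the square of indices
  from 1 to n + m.
\<close>

definition corner_array :: "nat \<Rightarrow> nat \<Rightarrow> (nat \<Rightarrow> nat \<Rightarrow> nat) \<Rightarrow> nat \<Rightarrow> nat \<Rightarrow> nat" where
  "corner_array n m a i j =
     (if i \<in> {1..n + m} \<and> j \<in> {1..n + m}
      then nat (max (int (a (i + n + m) j) - int (n + m) - int i + 1) 0) else 0)"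

end

(*
  Write M = n + m. Self-complementarity forces every box of [M]^3 into pi and every box with three
  coordinates > M out of it, and it exchanges the boxes with one and with two coordinates > M.
  Hence pi is determined by the relation q j p r := (M+p, j, M+r) : pi on [M]^3, which is a nested
  family of self-conjugate partitions, indexed by j. The order ideal condition between the regions
  with one and with two large coordinates reduces to: q j 1 r implies j + r <= M. A self-conjugate
  partition is in turn determined by the lengths of its rows counted from the diagonal onwards;
  they are strictly decreasing and otherwise arbitrary, and they form column j of the array c.
*)

theory Submission
  imports Defs
begin

section \<open>Symmetric self-complementary partitions from one octant\<close>

text \<open>The seven clauses follow the position of the large coordinates (those above
  \<open>M\<close>). With two large coordinates the small one becomes the index of \<open>q\<close>.
  With one large coordinate the box belongs exactly when its complement, which has two large ones,
  does not. There is no clause for three large coordinates, so such boxes are absent.\<close>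

definition assemble :: "nat \<Rightarrow> (nat \<Rightarrow> nat \<Rightarrow> nat \<Rightarrow> bool) \<Rightarrow> (nat \<times> nat \<times> nat) set" where
  "assemble M q = {(x, y, z). x \<in> {1..2 * M} \<and> y \<in> {1..2 * M} \<and> z \<in> {1..2 * M} \<and>
     ((x \<le> M \<and> y \<le> M \<and> z \<le> M) \<or>
      (x \<le> M \<and> M < y \<and> M < z \<and> q x (y - M) (z - M)) \<or>
      (M < x \<and> y \<le> M \<and> M < z \<and> q y (x - M) (z - M)) \<or>
      (M < x \<and> M < y \<and> z \<le> M \<and> q z (x - M) (y - M)) \<or>
      (M < x \<and> y \<le> M \<and> z \<le> M \<and> \<not> q (2 * M + 1 - x) (M + 1 - y) (M + 1 - z)) \<or>
      (x \<le> M \<and> M < y \<and> z \<le> M \<and> \<not> q (2 * M + 1 - y) (M + 1 - x) (M + 1 - z)) \<or>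
      (x \<le> M \<and> y \<le> M \<and> M < z \<and> \<not> q (2 * M + 1 - z) (M + 1 - x) (M + 1 - y)))}"

definition octant :: "nat \<Rightarrow> (nat \<times> nat \<times> nat) set \<Rightarrow> nat \<Rightarrow> nat \<Rightarrow> nat \<Rightarrow> bool" where
  "octant M \<pi> j p r \<longleftrightarrow> (M + p, j, M + r) \<in> \<pi>"

text \<open>Monotonicity is required only in \<open>j\<close> and \<open>p\<close>, since symmetry
  transfers it to \<open>r\<close>. The bound is stated on the first row, the longest one, and
  expresses the compatibility of the regions with one and with two large coordinates.\<close>

definition octant_shape :: "nat \<Rightarrow> (nat \<Rightarrow> nat \<Rightarrow> nat \<Rightarrow> bool) \<Rightarrow> bool" where
  "octant_shape M q \<longleftrightarrow>
     (\<forall>j p r. q j p r \<longrightarrow> q j r p) \<and>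
     (\<forall>j p r j' p'. q j p r \<and> 1 \<le> j' \<and> j' \<le> j \<and> 1 \<le> p' \<and> p' \<le> p \<and> 1 \<le> r \<longrightarrow> q j' p' r) \<and>
     (\<forall>j r. q j 1 r \<and> 1 \<le> j \<and> 1 \<le> r \<longrightarrow> j + r \<le> M)"

lemma octant_shapeD:
  assumes "octant_shape M q"
  shows octant_shape_sym: "q j p r \<longleftrightarrow> q j r p"
    and octant_shape_mono: "q j p r \<Longrightarrow> 1 \<le> j' \<Longrightarrow> j' \<le> j \<Longrightarrow> 1 \<le> p' \<Longrightarrow> p' \<le> p \<Longrightarrow>
      1 \<le> r' \<Longrightarrow> r' \<le> r \<Longrightarrow> q j' p' r'"
    and octant_shape_bound: "q j p r \<Longrightarrow> 1 \<le> j \<Longrightarrow> 1 \<le> p \<Longrightarrow> 1 \<le> r \<Longrightarrow> j + r \<le> M"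
proof -
  have sym: "q j p r \<Longrightarrow> q j r p" for j p r
    using assms unfolding octant_shape_def by blast
  have mono: "q j p r \<Longrightarrow> 1 \<le> j' \<Longrightarrow> j' \<le> j \<Longrightarrow> 1 \<le> p' \<Longrightarrow> p' \<le> p \<Longrightarrow> 1 \<le> r \<Longrightarrow> q j' p' r"
    for j p r j' p'
    using assms unfolding octant_shape_def by blast
  show "q j p r \<longleftrightarrow> q j r p" using sym by blast
  show "q j' p' r'" if "q j p r" "1 \<le> j'" "j' \<le> j" "1 \<le> p'" "p' \<le> p" "1 \<le> r'" "r' \<le> r"
  proof -
    have "q j' p' r" using mono[OF that(1-5)] that by simp
    then have "q j' r' p'" using mono[OF sym, of j' p' r j' r'] that by simp
    then show ?thesis by (rule sym)
  qed
  show "j + r \<le> M" if "q j p r" "1 \<le> j" "1 \<le> p" "1 \<le> r"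
  proof -
    have "q j 1 r" using mono[OF that(1), of j 1] that by simp
    then show ?thesis using assms that unfolding octant_shape_def by blast
  qed
qed

lemma assemble_swap12:
  assumes "(x, y, z) \<in> assemble M q" "octant_shape M q"
  shows "(y, x, z) \<in> assemble M q"
proof -
  have "q z (x - M) (y - M) = q z (y - M) (x - M)"
    "q (2 * M + 1 - z) (M + 1 - x) (M + 1 - y) = q (2 * M + 1 - z) (M + 1 - y) (M + 1 - x)"
    using octant_shape_sym[OF assms(2)] by blast+
  then show ?thesis
    using assms(1) unfolding assemble_def mem_Collect_eq prod.case
    by (cases "x \<le> M"; cases "y \<le> M"; cases "z \<le> M"; simp)
qed

lemma assemble_swap23:
  assumes "(x, y, z) \<in> assemble M q" "octant_shape M q"
  shows "(x, z, y) \<in> assemble M q"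
proof -
  have "q x (y - M) (z - M) = q x (z - M) (y - M)"
    "q (2 * M + 1 - x) (M + 1 - y) (M + 1 - z) = q (2 * M + 1 - x) (M + 1 - z) (M + 1 - y)"
    using octant_shape_sym[OF assms(2)] by blast+
  then show ?thesis
    using assms(1) unfolding assemble_def mem_Collect_eq prod.case
    by (cases "x \<le> M"; cases "y \<le> M"; cases "z \<le> M"; simp)
qed

lemma totally_symmetric_assemble: "octant_shape M q \<Longrightarrow> totally_symmetric (assemble M q)"
  unfolding totally_symmetric_def by (meson assemble_swap12 assemble_swap23 empty_subsetI insert_subset)

text \<open>Holds for arbitrary \<open>q\<close>: the reflection of a coordinate \<open>t\<close> to
  \<open>2 * M + 1 - t\<close> exchanges small and large, so it pairs each clause about
  \<open>q\<close> with the clause about its negation, and the all-small cube with the absent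
  all-large one.\<close>

lemma self_complementary_assemble: "self_complementary M (assemble M q)"
proof -
  have "(x, y, z) \<in> assemble M q \<longleftrightarrow> (2 * M + 1 - x, 2 * M + 1 - y, 2 * M + 1 - z) \<notin> assemble M q"
    if "x \<in> {1..2 * M}" "y \<in> {1..2 * M}" "z \<in> {1..2 * M}" for x y z
  proof -
    have large: "Suc (2 * M) - t \<le> M \<longleftrightarrow> \<not> t \<le> M"
      and invol: "Suc (2 * M) - (Suc (2 * M) - t) = t"
      and small: "t \<le> M \<Longrightarrow> Suc (2 * M) - t - M = Suc M - t"
      and flip: "\<not> t \<le> M \<Longrightarrow> Suc M - (Suc (2 * M) - t) = t - M"
      and box: "Suc (2 * M) - t \<in> {1..2 * M}"
      if "t \<in> {1..2 * M}" for t using that by auto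
    have suc: "2 * M + 1 = Suc (2 * M)" "M + 1 = Suc M" by simp_all
    show ?thesis
      unfolding assemble_def mem_Collect_eq prod.case suc not_le[symmetric]
      by (cases "x \<le> M"; cases "y \<le> M"; cases "z \<le> M")
        (simp_all only: that large[OF that(1)] large[OF that(2)] large[OF that(3)]
          invol[OF that(1)] invol[OF that(2)] invol[OF that(3)]
          small[OF that(1)] small[OF that(2)] small[OF that(3)]
          flip[OF that(1)] flip[OF that(2)] flip[OF that(3)]
          box[OF that(1)] box[OF that(2)] box[OF that(3)] simp_thms)
  qed
  then show ?thesis unfolding self_complementary_def by blast
qed

text \<open>One coordinate suffices, since the other two follow by symmetry. If \<open>x\<close> and
  \<open>x'\<close> lie in the same half, the claim is monotonicity of \<open>q\<close>, used
  contrapositively in the negated clauses. The bound in \<open>octant_shape\<close> is needed when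
  \<open>x\<close> is large and \<open>x'\<close> small.\<close>

lemma assemble_antimono1:
  assumes q: "octant_shape M q" and m: "(x, y, z) \<in> assemble M q" and x': "1 \<le> x'" "x' \<le> x"
  shows "(x', y, z) \<in> assemble M q"
proof -
  note mono = octant_shape_mono[OF q]
  have box: "x \<in> {1..2 * M}" "y \<in> {1..2 * M}" "z \<in> {1..2 * M}" "x' \<in> {1..2 * M}"
    using m x' unfolding assemble_def by auto
  have cross: "j + r \<le> M" if "q j p r" "1 \<le> j" "1 \<le> p" "1 \<le> r" for j p r
    using octant_shape_bound[OF q] that by blast
  consider (ll) "x \<le> M" | (gl) "M < x" "x' \<le> M" | (gg) "M < x'" by linarith
  then show ?thesis
  proof cases
    case ll
    have "q x' (y - M) (z - M)" if "q x (y - M) (z - M)" "M < y" "M < z"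
      using that(1) by (rule mono) (use that x' in auto)
    moreover have "q (2 * M + 1 - y) (M + 1 - x) (M + 1 - z)"
      if "q (2 * M + 1 - y) (M + 1 - x') (M + 1 - z)" "z \<le> M"
      using that(1) by (rule mono) (use that x' ll box in auto)
    moreover have "q (2 * M + 1 - z) (M + 1 - x) (M + 1 - y)"
      if "q (2 * M + 1 - z) (M + 1 - x') (M + 1 - y)" "y \<le> M"
      using that(1) by (rule mono) (use that x' ll box in auto)
    moreover have "x' \<le> M" using ll x' by simp
    ultimately show ?thesis
      using m ll box unfolding assemble_def
      by (cases "y \<le> M"; cases "z \<le> M") auto
  next
    case gg
    have "q y (x' - M) (z - M)" if "q y (x - M) (z - M)" "M < z"
      using that(1) by (rule mono) (use that x' gg box in auto)
    moreover have "q z (x' - M) (y - M)" if "q z (x - M) (y - M)" "M < y"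
      using that(1) by (rule mono) (use that x' gg box in auto)
    moreover have "q (2 * M + 1 - x) (M + 1 - y) (M + 1 - z)"
      if "q (2 * M + 1 - x') (M + 1 - y) (M + 1 - z)" "y \<le> M" "z \<le> M"
      using that(1) by (rule mono) (use that x' gg box in auto)
    moreover have "M < x" using gg x' by simp
    ultimately show ?thesis
      using m gg box unfolding assemble_def
      by (cases "y \<le> M"; cases "z \<le> M") auto
  next
    case gl
    \<comment> \<open>The first conjunct puts the box with coordinates \<open>x\<close>,
      \<open>j\<close>, \<open>k\<close> into the partition, the second keeps the one with
      \<open>x'\<close>, \<open>j\<close>, \<open>k\<close> out. The bounds would give
      \<open>j + k \<le> 2 * M\<close> and \<open>2 * M + 2 \<le> j + k\<close>.\<close>
    have no: "\<not> (q j (x - M) (k - M) \<and> q (2 * M + 1 - k) (M + 1 - x') (M + 1 - j))"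
      if "j \<in> {1..M}" "k \<in> {M + 1..2 * M}" for j k
    proof
      assume a: "q j (x - M) (k - M) \<and> q (2 * M + 1 - k) (M + 1 - x') (M + 1 - j)"
      have "j + (k - M) \<le> M"
        by (rule cross[OF conjunct1[OF a]]) (use that gl in auto)
      moreover have "2 * M + 1 - k + (M + 1 - j) \<le> M"
        by (rule cross[OF conjunct2[OF a]]) (use that gl in auto)
      ultimately show False using that by auto
    qed
    show ?thesis
      using m gl box x' no[of y z] no[of z y] unfolding assemble_def
      by (cases "y \<le> M"; cases "z \<le> M") auto
  qed
qed

lemma plane_partition_assemble:
  assumes q: "octant_shape M q"
  shows "plane_partition (assemble M q)"
proof -
  have sub: "assemble M q \<subseteq> {1..2 * M} \<times> {1..2 * M} \<times> {1..2 * M}"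
    unfolding assemble_def by blast
  have "(x', y', z') \<in> assemble M q"
    if "(x, y, z) \<in> assemble M q" "1 \<le> x'" "x' \<le> x" "1 \<le> y'" "y' \<le> y" "1 \<le> z'" "z' \<le> z"
    for x y z x' y' z'
  proof -
    have "(y, x', z) \<in> assemble M q"
      using assemble_swap12[OF assemble_antimono1[OF q that(1-3)] q] .
    then have "(z, x', y') \<in> assemble M q"
      using assemble_antimono1[OF q _ that(4,5)] assemble_swap12[OF _ q] assemble_swap23[OF _ q]
      by meson
    then show ?thesis
      using assemble_antimono1[OF q _ that(6,7)] assemble_swap12[OF _ q] assemble_swap23[OF _ q]
      by meson
  qed
  moreover have "finite (assemble M q)"
    using finite_subset[OF sub] by blast
  ultimately show ?thesis
    using sub unfolding plane_partition_def by fastforce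
qed

lemma assemble_in_TSSCPP:
  assumes "octant_shape M q"
  shows "assemble M q \<in> TSSCPP M"
proof -
  have "assemble M q \<subseteq> {1..2 * M} \<times> {1..2 * M} \<times> {1..2 * M}"
    unfolding assemble_def by blast
  then show ?thesis
    using plane_partition_assemble[OF assms] totally_symmetric_assemble[OF assms]
      self_complementary_assemble[of M q]
    unfolding TSSCPP_def by blast
qed

lemma octant_assemble:
  assumes "j \<in> {1..M}" "1 \<le> p" "1 \<le> r"
  shows "octant M (assemble M q) j p r \<longleftrightarrow> p \<le> M \<and> r \<le> M \<and> q j p r"
  using assms unfolding octant_def assemble_def by auto

section \<open>Recovering a totally symmetric self-complementary partition from its octant\<close>

lemma TSSCPP_D:
  assumes "\<pi> \<in> TSSCPP M"
  shows TSSCPP_down: "(x, y, z) \<in> \<pi> \<Longrightarrow> 1 \<le> x' \<Longrightarrow> x' \<le> x \<Longrightarrow> 1 \<le> y' \<Longrightarrow> y' \<le> y \<Longrightarrow>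
      1 \<le> z' \<Longrightarrow> z' \<le> z \<Longrightarrow> (x', y', z') \<in> \<pi>"
    and TSSCPP_box: "(x, y, z) \<in> \<pi> \<Longrightarrow> x \<in> {1..2 * M} \<and> y \<in> {1..2 * M} \<and> z \<in> {1..2 * M}"
    and TSSCPP_swap12: "(x, y, z) \<in> \<pi> \<longleftrightarrow> (y, x, z) \<in> \<pi>"
    and TSSCPP_swap23: "(x, y, z) \<in> \<pi> \<longleftrightarrow> (x, z, y) \<in> \<pi>"
    and TSSCPP_compl: "x \<in> {1..2 * M} \<Longrightarrow> y \<in> {1..2 * M} \<Longrightarrow> z \<in> {1..2 * M} \<Longrightarrow>
      (x, y, z) \<in> \<pi> \<longleftrightarrow> (2 * M + 1 - x, 2 * M + 1 - y, 2 * M + 1 - z) \<notin> \<pi>"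
proof -
  have p: "plane_partition \<pi>" "\<pi> \<subseteq> {1..2 * M} \<times> {1..2 * M} \<times> {1..2 * M}"
    "totally_symmetric \<pi>" "self_complementary M \<pi>"
    using assms unfolding TSSCPP_def by auto
  show "(x', y', z') \<in> \<pi>" if "(x, y, z) \<in> \<pi>" "1 \<le> x'" "x' \<le> x" "1 \<le> y'" "y' \<le> y" "1 \<le> z'" "z' \<le> z"
    using p(1) that unfolding plane_partition_def by blast
  show "x \<in> {1..2 * M} \<and> y \<in> {1..2 * M} \<and> z \<in> {1..2 * M}" if "(x, y, z) \<in> \<pi>"
    using p(2) that by blast
  show "(x, y, z) \<in> \<pi> \<longleftrightarrow> (y, x, z) \<in> \<pi>" "(x, y, z) \<in> \<pi> \<longleftrightarrow> (x, z, y) \<in> \<pi>"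
    using p(3) unfolding totally_symmetric_def by blast+
  show "(x, y, z) \<in> \<pi> \<longleftrightarrow> (2 * M + 1 - x, 2 * M + 1 - y, 2 * M + 1 - z) \<notin> \<pi>"
    if "x \<in> {1..2 * M}" "y \<in> {1..2 * M}" "z \<in> {1..2 * M}"
    using p(4) that unfolding self_complementary_def by blast
qed

text \<open>The complement of such a box lies below it, so both would belong to
  \<open>\<pi>\<close>.\<close>

lemma TSSCPP_not_all_large:
  assumes "\<pi> \<in> TSSCPP M" "M < x" "M < y" "M < z"
  shows "(x, y, z) \<notin> \<pi>"
proof
  assume a: "(x, y, z) \<in> \<pi>"
  have b: "x \<in> {1..2 * M}" "y \<in> {1..2 * M}" "z \<in> {1..2 * M}" using TSSCPP_box[OF assms(1) a] by auto
  have "(2 * M + 1 - x, 2 * M + 1 - y, 2 * M + 1 - z) \<in> \<pi>"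
    by (rule TSSCPP_down[OF assms(1) a]) (use b assms in auto)
  then show False using TSSCPP_compl[OF assms(1) b] a by blast
qed

lemma octant_shape_octant:
  assumes t: "\<pi> \<in> TSSCPP M"
  shows "octant_shape M (octant M \<pi>)"
  unfolding octant_shape_def
proof (intro conjI allI impI)
  show "octant M \<pi> j r p" if "octant M \<pi> j p r" for j p r
    using that TSSCPP_swap12[OF t] TSSCPP_swap23[OF t] unfolding octant_def by meson
  show "octant M \<pi> j' p' r"
    if "octant M \<pi> j p r \<and> 1 \<le> j' \<and> j' \<le> j \<and> 1 \<le> p' \<and> p' \<le> p \<and> 1 \<le> r" for j p r j' p'
    using that unfolding octant_def by (auto intro: TSSCPP_down[OF t])
  show "j + r \<le> M" if "octant M \<pi> j 1 r \<and> 1 \<le> j \<and> 1 \<le> r" for j r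
  proof (rule ccontr)
    assume g: "\<not> j + r \<le> M"
    have a: "(M + 1, j, M + r) \<in> \<pi>" and jr: "1 \<le> j" "1 \<le> r" using that unfolding octant_def by auto
    have b: "M + 1 \<in> {1..2 * M}" "j \<in> {1..2 * M}" "M + r \<in> {1..2 * M}"
      using TSSCPP_box[OF t a] by auto
    have j: "j \<le> M" using TSSCPP_not_all_large[OF t, of "M + 1" j "M + r"] a jr by force
    \<comment> \<open>After this swap the complement of the original box lies below the permuted
      one: \<open>2 * M + 1 - j \<le> M + r\<close> and \<open>M + 1 - r \<le> j\<close> both say
      \<open>M < j + r\<close>.\<close>
    have "(M + 1, M + r, j) \<in> \<pi>" using a TSSCPP_swap23[OF t] by blast
    then have "(2 * M + 1 - (M + 1), 2 * M + 1 - j, 2 * M + 1 - (M + r)) \<in> \<pi>"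
      by (rule TSSCPP_down[OF t]) (use b jr g j in auto)
    then show False using TSSCPP_compl[OF t b] a by blast
  qed
qed

text \<open>Agreement on indices up to \<open>M\<close> is enough, because \<open>assemble\<close>
  consults \<open>q\<close> only there. Boxes with at least two large coordinates are compared
  directly, the others through their complements.\<close>

lemma assemble_octant:
  assumes t: "\<pi> \<in> TSSCPP M"
    and q: "\<And>j p r. j \<in> {1..M} \<Longrightarrow> p \<in> {1..M} \<Longrightarrow> r \<in> {1..M} \<Longrightarrow> q j p r \<longleftrightarrow> octant M \<pi> j p r"
  shows "assemble M q = \<pi>"
proof -
  have two: "(x, y, z) \<in> assemble M q \<longleftrightarrow> (x, y, z) \<in> \<pi>"
    if box: "x \<in> {1..2 * M}" "y \<in> {1..2 * M}" "z \<in> {1..2 * M}"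
      and large: "(M < x \<and> M < y) \<or> (M < x \<and> M < z) \<or> (M < y \<and> M < z)" for x y z
  proof -
    consider "M < x" "M < y" "M < z" | "M < x" "M < y" "z \<le> M" | "M < x" "y \<le> M" "M < z"
      | "x \<le> M" "M < y" "M < z"
      using large by linarith
    then show ?thesis
    proof cases
      case 1
      then show ?thesis using TSSCPP_not_all_large[OF t] unfolding assemble_def by auto
    next
      case 2
      have "q z (x - M) (y - M) \<longleftrightarrow> octant M \<pi> z (x - M) (y - M)"
        by (rule q) (use 2 box in auto)
      then have "(x, y, z) \<in> assemble M q \<longleftrightarrow> (x, z, y) \<in> \<pi>"
        using 2 box unfolding assemble_def octant_def by simp
      then show ?thesis using TSSCPP_swap23[OF t] by blast
    next
      case 3
      have "q y (x - M) (z - M) \<longleftrightarrow> octant M \<pi> y (x - M) (z - M)"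
        by (rule q) (use 3 box in auto)
      then show ?thesis
        using 3 box unfolding assemble_def octant_def by simp
    next
      case 4
      have "q x (y - M) (z - M) \<longleftrightarrow> octant M \<pi> x (y - M) (z - M)"
        by (rule q) (use 4 box in auto)
      then have "(x, y, z) \<in> assemble M q \<longleftrightarrow> (y, x, z) \<in> \<pi>"
        using 4 box unfolding assemble_def octant_def by simp
      then show ?thesis using TSSCPP_swap12[OF t] by blast
    qed
  qed
  have "(x, y, z) \<in> assemble M q \<longleftrightarrow> (x, y, z) \<in> \<pi>"
    if box: "x \<in> {1..2 * M}" "y \<in> {1..2 * M}" "z \<in> {1..2 * M}" for x y z
  proof (cases "(M < x \<and> M < y) \<or> (M < x \<and> M < z) \<or> (M < y \<and> M < z)")
    case True
    then show ?thesis using two box by blast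
  next
    case False
    have compl: "(x, y, z) \<in> assemble M q \<longleftrightarrow>
        (2 * M + 1 - x, 2 * M + 1 - y, 2 * M + 1 - z) \<notin> assemble M q"
      using self_complementary_assemble box unfolding self_complementary_def by blast
    have "(2 * M + 1 - x, 2 * M + 1 - y, 2 * M + 1 - z) \<in> assemble M q \<longleftrightarrow>
        (2 * M + 1 - x, 2 * M + 1 - y, 2 * M + 1 - z) \<in> \<pi>"
      by (rule two) (use False box in auto)
    then show ?thesis using compl TSSCPP_compl[OF t box] by blast
  qed
  moreover have "(x, y, z) \<in> assemble M q \<Longrightarrow> x \<in> {1..2 * M} \<and> y \<in> {1..2 * M} \<and> z \<in> {1..2 * M}"
    for x y z
    unfolding assemble_def by blast
  ultimately show ?thesis using TSSCPP_box[OF t] by (metis subrelI subset_antisym surj_pair subsetI)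
qed

section \<open>Self-conjugate partitions and strict partitions\<close>

text \<open>Row \<^term>\<open>p\<close> of the partition with index \<^term>\<open>j\<close> has \<^term>\<open>c p j\<close> cells on and beyond
  the diagonal.\<close>

definition double :: "(nat \<Rightarrow> nat \<Rightarrow> nat) \<Rightarrow> nat \<Rightarrow> nat \<Rightarrow> nat \<Rightarrow> bool" where
  "double c j p r \<longleftrightarrow> max p r < min p r + c (min p r) j"

lemma plane_partition_array_support:
  assumes c: "plane_partition_array c" and nz: "c i j \<noteq> 0"
  shows "1 \<le> i \<and> 1 \<le> j"
proof (rule ccontr)
  assume "\<not> (1 \<le> i \<and> 1 \<le> j)"
  then have "i = 0 \<or> j = 0" by linarith
  then have "c i j = 0"
    by (rule conjunct1[OF c[unfolded plane_partition_array_def], rule_format])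
  then show False using nz by contradiction
qed

lemma plane_partition_array_antimono:
  assumes c: "plane_partition_array c" and "1 \<le> i" "i \<le> i'" "1 \<le> j" "j \<le> j'"
  shows "c i' j' \<le> c i j"
proof -
  have row: "c k (l + 1) \<le> c k l" and col: "c (k + 1) l \<le> c k l" if "1 \<le> k" "1 \<le> l" for k l
    using c that unfolding plane_partition_array_def by blast+
  have "c i' j' \<le> c i j'" using assms(3)
  proof (induction i' rule: dec_induct)
    case (step k)
    then show ?case using col[of k j'] assms(2,4,5) by simp
  qed simp
  also have "c i j' \<le> c i j" using assms(5)
  proof (induction j' rule: dec_induct)
    case (step k)
    then show ?case using row[of i k] assms(2,4) by simp
  qed simp
  finally show ?thesis .
qed

text \<open>In the self-conjugate partition coded by column \<open>j\<close>, the value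
  \<open>i + c i j\<close> is one past the end of row \<open>i\<close>. Each step down lowers a
  nonzero entry by at least one, so these ends weakly decrease; below the last nonzero entry the sum
  would grow again.\<close>

lemma column_strict_shift:
  assumes c: "plane_partition_array c"
    and s: "\<And>i i'. i < i' \<Longrightarrow> c i j \<noteq> 0 \<Longrightarrow> c i' j \<noteq> 0 \<Longrightarrow> c i' j < c i j"
    and "1 \<le> i" "i \<le> i'" "1 \<le> j" "c i' j \<noteq> 0"
  shows "i' + c i' j \<le> i + c i j"
  using assms(4,6)
proof (induction i' rule: dec_induct)
  case (step k)
  have "c (Suc k) j \<le> c k j"
    by (rule plane_partition_array_antimono[OF c]) (use step assms in auto)
  then show ?case using step s[of k "Suc k"] by force
qed simp

text \<open>The first row dominates all others and decreases weakly, so the nonzero columns form an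
  initial segment.\<close>

lemma columns_le_iff:
  assumes c: "plane_partition_array c"
  shows "card {j. \<exists>i. c i j \<noteq> 0} \<le> n \<longleftrightarrow> c 1 (n + 1) = 0"
proof
  have "{j. \<exists>i. c i j \<noteq> 0} = snd ` {(i, j). c i j \<noteq> 0}" by force
  moreover have "finite {(i, j). c i j \<noteq> 0}"
    using c unfolding plane_partition_array_def by blast
  ultimately have fin: "finite {j. \<exists>i. c i j \<noteq> 0}" by simp
  show "c 1 (n + 1) = 0" if "card {j. \<exists>i. c i j \<noteq> 0} \<le> n"
  proof (rule ccontr)
    assume "c 1 (n + 1) \<noteq> 0"
    then have "c 1 j \<noteq> 0" if "j \<in> {1..n + 1}" for j
      using plane_partition_array_antimono[OF c, of 1 1 j "n + 1"] that by simp
    then have "{1..n + 1} \<subseteq> {j. \<exists>i. c i j \<noteq> 0}" by blast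
    from card_mono[OF fin this] that show False by simp
  qed
  show "card {j. \<exists>i. c i j \<noteq> 0} \<le> n" if "c 1 (n + 1) = 0"
  proof -
    have "j \<in> {1..n}" if "c i j \<noteq> 0" for i j
    proof -
      have "1 \<le> i" "1 \<le> j"
        using plane_partition_array_support[OF c that] by blast+
      then have "\<not> n + 1 \<le> j"
        using plane_partition_array_antimono[OF c, of 1 i "n + 1" j] that \<open>c 1 (n + 1) = 0\<close> by auto
      then show ?thesis using \<open>1 \<le> j\<close> by simp
    qed
    then have "{j. \<exists>i. c i j \<noteq> 0} \<subseteq> {1..n}" by blast
    from card_mono[OF _ this] show ?thesis by simp
  qed
qed

text \<open>The column bound is applied to the top entry of column \<open>j\<close>; each of the
  \<open>i - 1\<close> steps down to row \<open>i\<close> then costs at least one.\<close>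

lemma C_set_entry_bound:
  assumes "c \<in> C_set n m" "c i j \<noteq> 0"
  shows "1 \<le> i" "1 \<le> j" "i + c i j + j \<le> n + m + 1"
proof -
  have c: "plane_partition_array c" using assms(1) unfolding C_set_def by blast
  show ij: "1 \<le> i" "1 \<le> j"
    using plane_partition_array_support[OF c assms(2)] by blast+
  have "c 1 j \<noteq> 0" using plane_partition_array_antimono[OF c, of 1 i j j] ij assms(2) by simp
  then have "c 1 j + j \<le> n + m" using assms(1) unfolding C_set_def by blast
  moreover have "i + c i j \<le> 1 + c 1 j"
    by (rule column_strict_shift[OF c]) (use assms ij in \<open>auto simp: C_set_def\<close>)
  ultimately show "i + c i j + j \<le> n + m + 1" by simp
qed

lemma octant_shape_double:
  assumes C: "c \<in> C_set n m"
  shows "octant_shape (n + m) (double c)"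
  unfolding octant_shape_def
proof (intro conjI allI impI)
  have c: "plane_partition_array c" using C unfolding C_set_def by blast
  show "double c j r p" if "double c j p r" for j p r
    using that unfolding double_def by (simp add: max.commute min.commute)
  show "double c j' p' r"
    if "double c j p r \<and> 1 \<le> j' \<and> j' \<le> j \<and> 1 \<le> p' \<and> p' \<le> p \<and> 1 \<le> r" for j p r j' p'
  proof -
    have d: "max p r < min p r + c (min p r) j" using that unfolding double_def by blast
    have le: "min p' r \<le> min p r" "max p' r \<le> max p r" using that by auto
    \<comment> \<open>The cell lies in row \<open>min p r\<close> at column \<open>max p r\<close>.
      Passing to \<open>p'\<close> moves it up and left, where rows end no earlier; passing from
      \<open>j\<close> to \<open>j'\<close> only lengthens rows.\<close>
    have "min p r + c (min p r) j \<le> min p' r + c (min p' r) j"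
      by (rule column_strict_shift[OF c]) (use C that le d in \<open>auto simp: C_set_def\<close>)
    also have "c (min p' r) j \<le> c (min p' r) j'"
      by (rule plane_partition_array_antimono[OF c]) (use that in auto)
    finally show ?thesis using d le unfolding double_def by linarith
  qed
  show "j + r \<le> n + m" if "double c j 1 r \<and> 1 \<le> j \<and> 1 \<le> r" for j r
    using that C_set_entry_bound(3)[OF C, of 1 j] unfolding double_def by (cases "c 1 j = 0") auto
qed

section \<open>The corner array\<close>

lemma height_iff:
  assumes "plane_partition \<pi>" "1 \<le> z"
  shows "(x, y, z) \<in> \<pi> \<longleftrightarrow> z \<le> height \<pi> x y"
proof -
  let ?Z = "{z. (x, y, z) \<in> \<pi>}"
  have down: "(x, y, z) \<in> \<pi> \<Longrightarrow> 1 \<le> z' \<Longrightarrow> z' \<le> z \<Longrightarrow> (x, y, z') \<in> \<pi>" for z z'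
    using assms(1) unfolding plane_partition_def by blast
  have pos: "(x, y, z) \<in> \<pi> \<Longrightarrow> 1 \<le> z" for z
    using assms(1) unfolding plane_partition_def by blast
  have "?Z \<subseteq> (snd \<circ> snd) ` \<pi>" by force
  then have fin: "finite ?Z"
    using assms(1) finite_subset unfolding plane_partition_def by blast
  show ?thesis
  proof
    assume "(x, y, z) \<in> \<pi>"
    then have "{1..z} \<subseteq> ?Z" using down by auto
    from card_mono[OF fin this] show "z \<le> height \<pi> x y" unfolding height_def by simp
  next
    assume h: "z \<le> height \<pi> x y"
    show "(x, y, z) \<in> \<pi>"
    proof (rule ccontr)
      assume n: "(x, y, z) \<notin> \<pi>"
      have "z' \<in> {1..<z}" if "(x, y, z') \<in> \<pi>" for z'
        using pos[OF that] down[OF that assms(2)] n by (meson atLeastLessThan_iff not_le)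
      then have "?Z \<subseteq> {1..<z}" by blast
      then have "card ?Z \<le> z - 1" using card_mono[of "{1..<z}" ?Z] by simp
      then show False using h assms(2) unfolding height_def by simp
    qed
  qed
qed

text \<open>The dictionary between the two sides: the entry counts the \<open>r \<ge> i\<close> for
  which cell \<open>i\<close>, \<open>r\<close> lies in the partition with index \<open>j\<close>,
  that is, the cells of row \<open>i\<close> from the diagonal onwards.\<close>

lemma corner_array_iff:
  assumes "plane_partition \<pi>" "i \<in> {1..n + m}" "j \<in> {1..n + m}" "i \<le> r"
  shows "r < i + corner_array n m (height \<pi>) i j \<longleftrightarrow> octant (n + m) \<pi> j i r"
proof -
  have "octant (n + m) \<pi> j i r \<longleftrightarrow> n + m + r \<le> height \<pi> (n + m + i) j"
    unfolding octant_def using height_iff[OF assms(1)] assms by simp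
  \<comment> \<open>With the \<open>+ 1\<close> placed before it, truncated subtraction reproduces
    the maximum with 0.\<close>
  moreover have "corner_array n m (height \<pi>) i j = height \<pi> (n + m + i) j + 1 - (n + m + i)"
    using assms(2,3) unfolding corner_array_def by (simp add: ac_simps)
  ultimately show ?thesis using assms(4) by linarith
qed

lemma double_corner_array:
  assumes t: "\<pi> \<in> TSSCPP (n + m)" and "j \<in> {1..n + m}" "p \<in> {1..n + m}" "r \<in> {1..n + m}"
  shows "double (corner_array n m (height \<pi>)) j p r \<longleftrightarrow> octant (n + m) \<pi> j p r"
proof -
  have "plane_partition \<pi>" using t unfolding TSSCPP_def by blast
  then show ?thesis
    using corner_array_iff[of \<pi> "min p r" n m j "max p r"] assms
      octant_shape_sym[OF octant_shape_octant[OF t], of j p r]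
    unfolding double_def by (cases "p \<le> r") (auto simp: min_def max_def)
qed

text \<open>A forbidden box has two coordinates above \<open>n + m\<close> and the third above
  \<open>n\<close>. Up to permutation the least such box is the one tested on the right, and
  \<open>\<pi>\<close> is closed downward.\<close>

lemma S_set_iff:
  "\<pi> \<in> S_set n m \<longleftrightarrow> \<pi> \<in> TSSCPP (n + m) \<and> \<not> octant (n + m) \<pi> (n + 1) 1 1"
proof (cases "\<pi> \<in> TSSCPP (n + m)")
  case t: True
  have "(\<forall>x\<in>{n + 1..n + 2 * m}. \<forall>y\<in>{n + 1..n + 2 * m}. \<forall>z\<in>{n + 1..n + 2 * m}.
       (x, y, z) \<in> \<pi> \<longrightarrow>
         (x \<le> n + m \<and> y \<le> n + m) \<or> (x \<le> n + m \<and> z \<le> n + m) \<or> (y \<le> n + m \<and> z \<le> n + m))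
     \<longleftrightarrow> (n + m + 1, n + 1, n + m + 1) \<notin> \<pi>" (is "?S \<longleftrightarrow> _")
  proof
    assume ?S
    show "(n + m + 1, n + 1, n + m + 1) \<notin> \<pi>"
    \<comment> \<open>For \<open>m = 0\<close> the central cube is empty and gives no information,
      but then the tested box has three large coordinates.\<close>
    proof (cases "m = 0")
      case True
      then show ?thesis using TSSCPP_not_all_large[OF t] by simp
    next
      case False
      then show ?thesis using \<open>?S\<close> by force
    qed
  next
    assume n: "(n + m + 1, n + 1, n + m + 1) \<notin> \<pi>"
    have no: "(x, y, z) \<notin> \<pi>" if "n + m < x" "n < y" "n + m < z" for x y z
      using n TSSCPP_down[OF t, of x y z "n + m + 1" "n + 1" "n + m + 1"] that by auto
    have perm: "(x, y, z) \<notin> \<pi> \<and> (y, x, z) \<notin> \<pi> \<and> (x, z, y) \<notin> \<pi>"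
      if "n + m < x" "n < y" "n + m < z" for x y z
      using no[OF that] TSSCPP_swap12[OF t] TSSCPP_swap23[OF t] by blast
    show ?S
    proof (intro ballI impI)
      fix x y z
      assume "x \<in> {n + 1..n + 2 * m}" "y \<in> {n + 1..n + 2 * m}" "z \<in> {n + 1..n + 2 * m}"
        and "(x, y, z) \<in> \<pi>"
      then show "(x \<le> n + m \<and> y \<le> n + m) \<or> (x \<le> n + m \<and> z \<le> n + m) \<or>
          (y \<le> n + m \<and> z \<le> n + m)"
        using perm[of x y z] perm[of y x z] perm[of x z y] by (simp add: Suc_le_eq) (meson not_le)
    qed
  qed
  then show ?thesis using t unfolding S_set_def octant_def by simp
qed (simp add: S_set_def)

section \<open>The two maps and their composition\<close>

lemma corner_array_in_C_set:
  assumes S: "\<pi> \<in> S_set n m"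
  shows "corner_array n m (height \<pi>) \<in> C_set n m"
proof -
  define M where "M = n + m"
  define c where "c = corner_array n m (height \<pi>)"
  have t: "\<pi> \<in> TSSCPP M" and col: "\<not> octant M \<pi> (n + 1) 1 1"
    using S unfolding S_set_iff M_def by auto
  have pp: "plane_partition \<pi>" using t unfolding TSSCPP_def by blast
  note shape = octant_shape_octant[OF t]
  have iff: "r < i + c i j \<longleftrightarrow> octant M \<pi> j i r" if "i \<in> {1..M}" "j \<in> {1..M}" "i \<le> r" for i j r
    using corner_array_iff[OF pp, of i n m j r] that unfolding c_def M_def by simp
  have out: "c i j = 0" if "\<not> (i \<in> {1..M} \<and> j \<in> {1..M})" for i j
    using that unfolding c_def M_def corner_array_def by (rule if_not_P)
  \<comment> \<open>\<open>i + c i j - 1\<close> is the column of the last cell of row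
    \<open>i\<close>.\<close>
  have cell: "i \<in> {1..M} \<and> j \<in> {1..M} \<and> octant M \<pi> j i (i + c i j - 1)" if "c i j \<noteq> 0" for i j
    using iff[of i j "i + c i j - 1"] out[of i j] that by (cases "i \<in> {1..M} \<and> j \<in> {1..M}") auto
  \<comment> \<open>The last cell of row \<open>i'\<close>, moved up to row \<open>i\<close>, stays
    in the partition, so row \<open>i\<close> ends at least as far right; as it starts further left
    on the diagonal, its entry is strictly larger.\<close>
  have strict: "c i' j < c i j" if "i < i'" "1 \<le> i" "c i' j \<noteq> 0" for i i' j
  proof -
    have "octant M \<pi> j i (i' + c i' j - 1)"
      by (rule octant_shape_mono[OF shape, of j i' "i' + c i' j - 1"]) (use cell[OF that(3)] that in auto)
    then have "i' + c i' j - 1 < i + c i j"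
      using iff[of i j "i' + c i' j - 1"] cell[OF that(3)] that by auto
    then show ?thesis using that by linarith
  qed
  have row: "c i (j + 1) \<le> c i j" if "1 \<le> j" for i j
  proof (cases "c i (j + 1) = 0")
    case False
    have "octant M \<pi> j i (i + c i (j + 1) - 1)"
      by (rule octant_shape_mono[OF shape, of "j + 1" i "i + c i (j + 1) - 1"])
        (use cell[OF False] that False in auto)
    then have "i + c i (j + 1) - 1 < i + c i j"
      using iff[of i j "i + c i (j + 1) - 1"] cell[OF False] that False by auto
    then show ?thesis by linarith
  qed simp
  have "c (i + 1) j \<le> c i j" if "1 \<le> i" for i j
    using strict[of i "i + 1" j] that by (cases "c (i + 1) j = 0") auto
  moreover have "finite {(i, j). c i j \<noteq> 0}"
    by (rule finite_subset[of _ "{1..M} \<times> {1..M}"]) (use cell in auto)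
  moreover have "c i j = 0" if "i = 0 \<or> j = 0" for i j
    using out[of i j] that by auto
  ultimately have ppa: "plane_partition_array c"
    using row unfolding plane_partition_array_def by blast
  \<comment> \<open>If \<open>n + 1 \<le> M\<close>, the excluded cell is the corner of the
    partition with index \<open>n + 1\<close>; otherwise the array is 0 there by definition.\<close>
  have "c 1 (n + 1) = 0"
    using iff[of 1 "n + 1" 1] out[of 1 "n + 1"] col by fastforce
  then have "card {j. \<exists>i. c i j \<noteq> 0} \<le> n" using columns_le_iff[OF ppa] by blast
  moreover have "c i j + j \<le> M" if "c i j \<noteq> 0" for i j
    using octant_shape_bound[OF shape, of j i "i + c i j - 1"] cell[OF that] that by force
  moreover have "c i' j < c i j" if "i < i'" "c i j \<noteq> 0" "c i' j \<noteq> 0" for i i' j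
    using strict[of i i' j] cell[OF that(2)] that by auto
  ultimately show ?thesis
    using ppa unfolding C_set_def c_def[symmetric] M_def by blast
qed

lemma assemble_double_in_S_set:
  assumes C: "c \<in> C_set n m"
  shows "assemble (n + m) (double c) \<in> S_set n m"
proof -
  have t: "assemble (n + m) (double c) \<in> TSSCPP (n + m)"
    using assemble_in_TSSCPP octant_shape_double[OF C] by blast
  have "c 1 (n + 1) = 0" using C columns_le_iff unfolding C_set_def by blast
  \<comment> \<open>For \<open>m = 0\<close> the index \<open>n + 1\<close> exceeds
    \<open>n + m\<close>, so \<open>octant_assemble\<close> does not apply and the box is excluded
    as all-large.\<close>
  then have "\<not> octant (n + m) (assemble (n + m) (double c)) (n + 1) 1 1"
    using octant_assemble[of "n + 1" "n + m" 1 1 "double c"]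
      TSSCPP_not_all_large[OF t, of "n + m + 1" "n + 1" "n + m + 1"]
    by (cases "m = 0") (auto simp: double_def octant_def)
  then show ?thesis using t unfolding S_set_iff by blast
qed

lemma corner_array_assemble_double:
  assumes C: "c \<in> C_set n m"
  shows "corner_array n m (height (assemble (n + m) (double c))) = c"
proof (intro ext)
  fix i j
  let ?d = "corner_array n m (height (assemble (n + m) (double c)))"
  show "?d i j = c i j"
  proof (cases "i \<in> {1..n + m} \<and> j \<in> {1..n + m}")
    case True
    have pp: "plane_partition (assemble (n + m) (double c))"
      by (rule plane_partition_assemble[OF octant_shape_double[OF C]])
    \<comment> \<open>Both entries are compared through their thresholds. The restriction
      \<open>r \<le> n + m\<close> from \<open>octant_assemble\<close> is harmless, since
      \<open>C_set_entry_bound\<close> keeps every row of the doubled partition within that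
      range.\<close>
    have "r < i + ?d i j \<longleftrightarrow> r < i + c i j" if "i \<le> r" for r
    proof -
      have "r < i + ?d i j \<longleftrightarrow> r \<le> n + m \<and> double c j i r"
        using corner_array_iff[OF pp] octant_assemble[of j "n + m" i r "double c"] True that by auto
      also have "\<dots> \<longleftrightarrow> r < i + c i j"
        using C_set_entry_bound(3)[OF C, of i j] that True
        by (cases "c i j = 0") (auto simp: double_def min_def max_def)
      finally show ?thesis .
    qed
    \<comment> \<open>At its own threshold one side is false, which gives the two
      inequalities.\<close>
    from this[of "i + ?d i j"] this[of "i + c i j"] show ?thesis by auto
  next
    case False
    then have "c i j = 0" using C_set_entry_bound[OF C, of i j] by fastforce
    then show ?thesis using False unfolding corner_array_def by auto
  qed
qed

theorem theorem3p5:
  fixes n m :: nat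
  assumes "n \<ge> 1"
  shows "(\<forall>\<pi>\<in>S_set n m. corner_array n m (height \<pi>) \<in> C_set n m) \<and>
         bij_betw (\<lambda>\<pi>. corner_array n m (height \<pi>)) (S_set n m) (C_set n m)"
proof
  show into: "\<forall>\<pi>\<in>S_set n m. corner_array n m (height \<pi>) \<in> C_set n m"
    using corner_array_in_C_set by blast
  show "bij_betw (\<lambda>\<pi>. corner_array n m (height \<pi>)) (S_set n m) (C_set n m)"
  proof (rule bij_betw_byWitness[where f' = "\<lambda>c. assemble (n + m) (double c)"])
    show "\<forall>\<pi>\<in>S_set n m. assemble (n + m) (double (corner_array n m (height \<pi>))) = \<pi>"
    proof
      fix \<pi>
      assume "\<pi> \<in> S_set n m"
      then have t: "\<pi> \<in> TSSCPP (n + m)" unfolding S_set_def by blast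
      show "assemble (n + m) (double (corner_array n m (height \<pi>))) = \<pi>"
        by (rule assemble_octant[OF t double_corner_array[OF t]])
    qed
    show "\<forall>c\<in>C_set n m. corner_array n m (height (assemble (n + m) (double c))) = c"
      using corner_array_assemble_double by blast
    show "(\<lambda>\<pi>. corner_array n m (height \<pi>)) ` S_set n m \<subseteq> C_set n m"
      using into by blast
    show "(\<lambda>c. assemble (n + m) (double c)) ` C_set n m \<subseteq> S_set n m"
      using assemble_double_in_S_set by blast
  qed
qed

end
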